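(* Let $L>0$ and let $\mathcal A$ be any nonadaptive horizon-independent linear-span method, i.e. any real array $(\beta_{i,k})_{0\le i<k}$ defining iterates $x_k=x_0-\frac1L\sum_{i=0}^{k-1}\beta_{i,k}\nabla f(x_i)$ for $k\ge1$. Then $$\limsup_{N\to\infty} N\,\mathcal G_N(\mathcal A)\ge\frac12 .$$ Moreover, this lower bound already holds for one-dimensional objectives: if $\mathcal G_N^{(1)}(\mathcal A)$ denotes the quantity obtained by restricting the supremum defining $\mathcal G_N(\mathcal A)$ to dimension $d=1$, then $\limsup_{N\to\infty} N\,\mathcal G^{(1)}_N(\mathcal A)\ge\frac12$.
   Context: Fix $L>0$. $\mathcal F_{0,L}(\mathbb R^d)$ is the class of convex differentiable functions $f:\mathbb R^d\to\mathbb R$ that admit a minimizer and whose gradient is $L$-Lipschitz (Euclidean norm); $f_\star:=\min f$. A nonadaptive horizon-independent linear-span method $\mathcal A$ is given by a single infinite array of real coefficients $(\beta_{i,k})_{0\le i<k}$, fixed in advance (independent of $f$, of $x_0$, of the dimension, of all observed gradients, and of any stopping horizon). Applied to $f$ and $x_0$ it generates $x_k=x_0-\frac1L\sum_{i=0}^{k-1}\beta_{i,k}\nabla f(x_i)$, $k\ge1$. Its worst-case bound after $N$ iterations is $$\mathcal G_N(\mathcal A):=\sup_{d\ge1,\ f\in\mathcal F_{0,L}(\mathbb R^d),\ x_0\in\mathbb R^d,\ f(x_0)>f_\star}\frac{\|\nabla f(x_N)\|^2}{L(f(x_0)-f_\star)}.$$ The worst-case $f$ may depend on $N$. *)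

theory Defs
  imports "HOL-Analysis.Analysis"
begin

text \<open>
  The supremum over all dimensions $d$ rules out a dimension that is a type. Following
  \<^const>\<open>Euclidean_space\<close>, a point of $R^d$ is a sequence that vanishes from index $d$ on.
  Objective functions have type \<^typ>\<open>(nat \<Rightarrow> real) \<Rightarrow> real\<close>; only their values on \<open>Rn d\<close> matter.
\<close>

abbreviation Rn :: "nat \<Rightarrow> (nat \<Rightarrow> real) set" where
  "Rn d \<equiv> topspace (Euclidean_space d)"

definition einner :: "nat \<Rightarrow> (nat \<Rightarrow> real) \<Rightarrow> (nat \<Rightarrow> real) \<Rightarrow> real" where
  "einner d x y = (\<Sum>i<d. x i * y i)"

definition enorm :: "nat \<Rightarrow> (nat \<Rightarrow> real) \<Rightarrow> real" where
  "enorm d x = L2_set x {..<d}"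

definition has_gradient ::
    "nat \<Rightarrow> ((nat \<Rightarrow> real) \<Rightarrow> real) \<Rightarrow> (nat \<Rightarrow> real) \<Rightarrow> (nat \<Rightarrow> real) \<Rightarrow> bool" where
  "has_gradient d f g x \<longleftrightarrow> g \<in> Rn d \<and>
     (\<forall>\<epsilon>>0. \<exists>\<delta>>0. \<forall>y\<in>Rn d. enorm d (\<lambda>i. y i - x i) < \<delta> \<longrightarrow>
        \<bar>f y - f x - einner d g (\<lambda>i. y i - x i)\<bar> \<le> \<epsilon> * enorm d (\<lambda>i. y i - x i))"

definition gradient :: "nat \<Rightarrow> ((nat \<Rightarrow> real) \<Rightarrow> real) \<Rightarrow> (nat \<Rightarrow> real) \<Rightarrow> (nat \<Rightarrow> real)" where
  "gradient d f x = (THE g. has_gradient d f g x)"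

definition smooth_convex :: "nat \<Rightarrow> real \<Rightarrow> ((nat \<Rightarrow> real) \<Rightarrow> real) \<Rightarrow> bool" where
  "smooth_convex d L f \<longleftrightarrow>
     (\<forall>x\<in>Rn d. \<forall>y\<in>Rn d. \<forall>t\<in>{0..1}.
        f (\<lambda>i. (1 - t) * x i + t * y i) \<le> (1 - t) * f x + t * f y) \<and>
     (\<forall>x\<in>Rn d. \<exists>g. has_gradient d f g x) \<and>
     (\<exists>z\<in>Rn d. \<forall>x\<in>Rn d. f z \<le> f x) \<and>
     (\<forall>x\<in>Rn d. \<forall>y\<in>Rn d.
        enorm d (\<lambda>i. gradient d f x i - gradient d f y i) \<le> L * enorm d (\<lambda>i. x i - y i))"

definition fstar :: "nat \<Rightarrow> ((nat \<Rightarrow> real) \<Rightarrow> real) \<Rightarrow> real" where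
  "fstar d f = (INF x\<in>Rn d. f x)"

text \<open>
  The array is a total function \<open>\<beta>\<close>; only the entries \<open>\<beta> i k\<close> with \<open>i < k\<close> are used.
  For \<open>k = 0\<close> the sum is empty and the equation says that the iterate is \<open>x0\<close>.
\<close>

fun iterate :: "real \<Rightarrow> (nat \<Rightarrow> nat \<Rightarrow> real) \<Rightarrow> nat \<Rightarrow> ((nat \<Rightarrow> real) \<Rightarrow> real) \<Rightarrow>
    (nat \<Rightarrow> real) \<Rightarrow> nat \<Rightarrow> (nat \<Rightarrow> real)" where
  "iterate L \<beta> d f x0 k =
     (\<lambda>j. x0 j - 1 / L * (\<Sum>i<k. \<beta> i k * gradient d f (iterate L \<beta> d f x0 i) j))"

declare iterate.simps [simp del]

definition worst_case_dim :: "real \<Rightarrow> (nat \<Rightarrow> nat \<Rightarrow> real) \<Rightarrow> nat \<Rightarrow> nat \<Rightarrow> ereal" where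
  "worst_case_dim L \<beta> d N =
     (SUP (f, x0) \<in> {(f, x0). smooth_convex d L f \<and> x0 \<in> Rn d \<and> f x0 > fstar d f}.
        ereal ((enorm d (gradient d f (iterate L \<beta> d f x0 N)))\<^sup>2 / (L * (f x0 - fstar d f))))"

definition worst_case :: "real \<Rightarrow> (nat \<Rightarrow> nat \<Rightarrow> real) \<Rightarrow> nat \<Rightarrow> ereal" where
  "worst_case L \<beta> N = (SUP d\<in>{1..}. worst_case_dim L \<beta> d N)"

text \<open>The gradient is unique, so that \<^const>\<open>gradient\<close> is well defined.\<close>

lemma enorm_scale: "enorm d (\<lambda>i. t * x i) = \<bar>t\<bar> * enorm d x"
  by (simp add: enorm_def L2_set_def power_mult_distrib real_sqrt_mult flip: sum_distrib_left)

lemma einner_self: "einner d x x = (enorm d x)\<^sup>2"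
  by (simp add: enorm_def L2_set_def einner_def sum_nonneg power2_eq_square)

lemma has_gradient_unique:
  assumes g: "has_gradient d f g x" and h: "has_gradient d f h x" and x: "x \<in> Rn d"
  shows "g = h"
proof (rule ccontr)
  assume "g \<noteq> h"
  define w where "w = (\<lambda>i. g i - h i)"
  have gR: "g \<in> Rn d" and hR: "h \<in> Rn d"
    using g h by (auto simp: has_gradient_def)
  have wR: "w \<in> Rn d"
    using gR hR by (auto simp: w_def topspace_Euclidean_space)
  obtain j where "g j \<noteq> h j"
    using \<open>g \<noteq> h\<close> by blast
  then have "w j \<noteq> 0"
    by (simp add: w_def)
  then have "j < d"
    using wR unfolding topspace_Euclidean_space by (metis (mono_tags) mem_Collect_eq not_le)
  then have pos: "enorm d w > 0"
    using L2_set_eq_0_iff[of "{..<d}" w] L2_set_nonneg[of w "{..<d}"] \<open>w j \<noteq> 0\<close>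
    unfolding enorm_def by (auto simp: order_le_less)
  define e where "e = enorm d w / 4"
  have "e > 0" using pos by (simp add: e_def)
  have ex: "\<exists>\<delta>>0. \<forall>y\<in>Rn d. enorm d (\<lambda>i. y i - x i) < \<delta> \<longrightarrow>
      \<bar>f y - f x - einner d u (\<lambda>i. y i - x i)\<bar> \<le> e * enorm d (\<lambda>i. y i - x i)"
    if "has_gradient d f u x" for u
    using that \<open>e > 0\<close> by (simp add: has_gradient_def)
  obtain d1 where d1: "d1 > 0" "\<forall>y\<in>Rn d. enorm d (\<lambda>i. y i - x i) < d1 \<longrightarrow>
      \<bar>f y - f x - einner d g (\<lambda>i. y i - x i)\<bar> \<le> e * enorm d (\<lambda>i. y i - x i)"
    using ex[OF g] by blast
  obtain d2 where d2: "d2 > 0" "\<forall>y\<in>Rn d. enorm d (\<lambda>i. y i - x i) < d2 \<longrightarrow>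
      \<bar>f y - f x - einner d h (\<lambda>i. y i - x i)\<bar> \<le> e * enorm d (\<lambda>i. y i - x i)"
    using ex[OF h] by blast
  define t where "t = min d1 d2 / (2 * enorm d w)"
  have t: "t > 0" using pos d1(1) d2(1) by (simp add: t_def)
  have tw: "t * enorm d w < d1" "t * enorm d w < d2"
    using pos d1(1) d2(1) by (auto simp: t_def)
  define y where "y = (\<lambda>i. x i + t * w i)"
  have yR: "y \<in> Rn d"
    using x wR by (simp add: y_def topspace_Euclidean_space)
  have diff: "(\<lambda>i. y i - x i) = (\<lambda>i. t * w i)"
    by (simp add: y_def)
  have n: "enorm d (\<lambda>i. t * w i) = t * enorm d w"
    using t by (simp add: enorm_scale)
  have "einner d g (\<lambda>i. t * w i) - einner d h (\<lambda>i. t * w i) = t * einner d w w"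
    by (simp add: einner_def w_def sum_distrib_left algebra_simps flip: sum_subtractf)
  then have "t * (enorm d w)\<^sup>2 \<le> 2 * (e * (t * enorm d w))"
    using bspec[OF d1(2) yR] bspec[OF d2(2) yR] tw unfolding diff n einner_self by linarith
  also have "\<dots> = t * (enorm d w)\<^sup>2 / 2"
    by (simp add: e_def power2_eq_square)
  finally show False
    using t pos by (simp add: field_simps)
qed

lemma gradient_eqI: "has_gradient d f g x \<Longrightarrow> x \<in> Rn d \<Longrightarrow> gradient d f x = g"
  unfolding gradient_def by (blast intro: has_gradient_unique)

lemma iterate_in_Rn:
  assumes "smooth_convex d L f" "x0 \<in> Rn d"
  shows "iterate L \<beta> d f x0 k \<in> Rn d"
proof (induction k rule: less_induct)
  case (less k)
  have "gradient d f (iterate L \<beta> d f x0 i) \<in> Rn d" if ik: "i < k" for i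
  proof -
    obtain g where g: "has_gradient d f g (iterate L \<beta> d f x0 i)"
      using less[OF ik] assms(1) by (auto simp: smooth_convex_def)
    then show ?thesis
      using gradient_eqI[OF g less[OF ik]] by (simp add: has_gradient_def)
  qed
  then show ?case
    using assms(2) by (subst iterate.simps) (auto simp: topspace_Euclidean_space)
qed

text \<open>
  For every Euclidean space of the library, coordinates with respect to an enumeration \<open>b\<close> of the
  standard basis identify it with \<open>Rn DIM('a)\<close>, and \<^const>\<open>smooth_convex\<close> with the
  corresponding class expressed by library notions.
\<close>

definition coords :: "(nat \<Rightarrow> 'a) \<Rightarrow> 'a::euclidean_space \<Rightarrow> nat \<Rightarrow> real" where
  "coords b x = (\<lambda>i. if i < DIM('a) then x \<bullet> b i else 0)"

context
  fixes b :: "nat \<Rightarrow> 'a::euclidean_space"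
  assumes b: "bij_betw b {..<DIM('a)} Basis"
begin

lemma coords_image: "range (coords b) = Rn DIM('a)"
proof
  show "range (coords b) \<subseteq> Rn DIM('a)"
    by (auto simp: coords_def topspace_Euclidean_space)
  show "Rn DIM('a) \<subseteq> range (coords b)"
  proof
    fix v assume v: "v \<in> Rn DIM('a)"
    define x where "x = (\<Sum>k\<in>Basis. v (the_inv_into {..<DIM('a)} b k) *\<^sub>R k)"
    have "x \<bullet> b i = v i" if "i < DIM('a)" for i
    proof -
      have "b i \<in> Basis" using b that by (auto simp: bij_betw_def)
      then have "x \<bullet> b i = v (the_inv_into {..<DIM('a)} b (b i))"
        by (simp add: x_def inner_sum_left_Basis)
      then show ?thesis
        using b that by (simp add: bij_betw_def the_inv_into_f_f)
    qed
    then have "coords b x = v"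
      using v by (auto simp: coords_def topspace_Euclidean_space)
    then show "v \<in> range (coords b)" by blast
  qed
qed

lemma coords_diff: "(\<lambda>i. coords b x i - coords b y i) = coords b (x - y)"
  by (auto simp: coords_def inner_diff_left)

lemma einner_coords: "einner DIM('a) (coords b x) (coords b y) = x \<bullet> y"
  unfolding einner_def coords_def euclidean_inner[of x y]
  by (simp add: sum.reindex_bij_betw[OF b, of "\<lambda>k. (x \<bullet> k) * (y \<bullet> k)", symmetric])

lemma enorm_coords: "enorm DIM('a) (coords b x) = norm x"
  by (metis einner_coords einner_self L2_set_nonneg enorm_def norm_eq_sqrt_inner real_sqrt_unique)

lemma has_gradient_coords:
  "has_gradient DIM('a) f (coords b g) (coords b x) \<longleftrightarrow>
     ((\<lambda>x. f (coords b x)) has_derivative (\<lambda>h. g \<bullet> h)) (at x)"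
  unfolding has_gradient_def has_derivative_within_alt coords_image[symmetric]
  by (simp add: coords_diff enorm_coords einner_coords bounded_linear_inner_right)

lemma smooth_convex_coords:
  "smooth_convex DIM('a) L f \<longleftrightarrow>
     (let F = (\<lambda>x. f (coords b x)) in
       convex_on UNIV F \<and> (\<exists>z. \<forall>x. F z \<le> F x) \<and>
       (\<exists>G. (\<forall>x. (F has_derivative (\<lambda>h. G x \<bullet> h)) (at x)) \<and>
            (\<forall>x y. norm (G x - G y) \<le> L * norm (x - y))))"
proof -
  have comb: "(\<lambda>i. (1 - t) * coords b x i + t * coords b y i) = coords b ((1 - t) *\<^sub>R x + t *\<^sub>R y)"
    for t x y by (auto simp: coords_def inner_add_left)
  have cvx: "(\<forall>x\<in>Rn DIM('a). \<forall>y\<in>Rn DIM('a). \<forall>t\<in>{0..1}.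
        f (\<lambda>i. (1 - t) * x i + t * y i) \<le> (1 - t) * f x + t * f y) \<longleftrightarrow>
      convex_on UNIV (\<lambda>x. f (coords b x))" (is "?l \<longleftrightarrow> ?r")
  proof
    assume ?l
    then show ?r
      unfolding coords_image[symmetric] by (intro convex_onI) (auto simp: comb)
  next
    assume ?r
    then show ?l
      unfolding coords_image[symmetric] by (auto simp: comb dest: convex_onD)
  qed
  have mini: "(\<exists>z\<in>Rn DIM('a). \<forall>x\<in>Rn DIM('a). f z \<le> f x) \<longleftrightarrow>
      (\<exists>z. \<forall>x. f (coords b z) \<le> f (coords b x))"
    unfolding coords_image[symmetric] by auto
  have "(\<forall>x\<in>Rn DIM('a). \<exists>g. has_gradient DIM('a) f g x) \<and>
      (\<forall>x\<in>Rn DIM('a). \<forall>y\<in>Rn DIM('a). enorm DIM('a)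
         (\<lambda>i. gradient DIM('a) f x i - gradient DIM('a) f y i) \<le> L * enorm DIM('a) (\<lambda>i. x i - y i)) \<longleftrightarrow>
      (\<exists>G. (\<forall>x. ((\<lambda>x. f (coords b x)) has_derivative (\<lambda>h. G x \<bullet> h)) (at x)) \<and>
            (\<forall>x y. norm (G x - G y) \<le> L * norm (x - y)))" (is "?D \<and> ?Lip \<longleftrightarrow> ?R")
  proof
    assume *: "?D \<and> ?Lip"
    have "\<exists>g. has_gradient DIM('a) f (coords b g) (coords b x)" for x
    proof -
      obtain g where "has_gradient DIM('a) f g (coords b x)"
        using * coords_image by blast
      moreover from this obtain g' where "g = coords b g'"
        unfolding has_gradient_def coords_image[symmetric] by blast
      ultimately show ?thesis by blast
    qed
    then obtain G where G: "\<And>x. has_gradient DIM('a) f (coords b (G x)) (coords b x)"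
      by metis
    have "gradient DIM('a) f (coords b x) = coords b (G x)" for x
      using gradient_eqI[OF G] coords_image by blast
    then have "\<forall>x y. norm (G x - G y) \<le> L * norm (x - y)"
      using * unfolding coords_image[symmetric] by (simp add: coords_diff enorm_coords)
    with G show ?R
      unfolding has_gradient_coords by blast
  next
    assume ?R
    then obtain G where G: "\<And>x. has_gradient DIM('a) f (coords b (G x)) (coords b x)"
      and Lip: "\<And>x y. norm (G x - G y) \<le> L * norm (x - y)"
      unfolding has_gradient_coords by blast
    have "gradient DIM('a) f (coords b x) = coords b (G x)" for x
      using gradient_eqI[OF G] coords_image by blast
    with G Lip show "?D \<and> ?Lip"
      unfolding coords_image[symmetric] by (auto simp: coords_diff enorm_coords)
  qed
  then show ?thesis
    unfolding smooth_convex_def Let_def cvx mini by blast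
qed

end

end

theory Submission
  imports Defs
begin

text \<open>
  One objective suffices: \<open>L\<close> times the function that is \<open>x\<^sup>2 / 2\<close> up to \<open>x = 1\<close> and has slope \<open>1\<close>
  beyond. Let \<open>s\<^sub>k\<close> be the sum of the coefficients of step \<open>k\<close> and \<open>m\<^sub>n = 1 / 2 + max {s\<^sub>k | k \<le> n}\<close>.
  Started so far to the right that the first \<open>N\<close> iterates only see slope \<open>1\<close>, the method has
  \<open>x\<^sub>k = x\<^sub>0 - s\<^sub>k\<close> for \<open>k \<le> N\<close>. If \<open>N\<close> times the worst case is eventually at most \<open>c < 1 / 2\<close>,
  then the start from which also \<open>x\<^sub>N\<close> is on the linear part forces \<open>m\<^sub>N \<ge> N / c\<close>. The start from
  which only the earlier iterates are, so that \<open>x\<^sub>N\<close> may overshoot into the steep part, forces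
  \<open>m\<^sub>N \<le> m\<^sub>N\<^sub>-\<^sub>1 + 1 + sqrt (c m\<^sub>N\<^sub>-\<^sub>1 / N)\<close>. The second condition makes \<open>m\<close> grow too slowly for the first.
\<close>

section \<open>The one-sided Huber function\<close>

definition half_huber :: "real \<Rightarrow> real" where
  "half_huber x = (if x \<le> 1 then x\<^sup>2 / 2 else x - 1 / 2)"

text \<open>This slope is nondecreasing and 1-Lipschitz, hence convexity and smoothness; it is
  bounded above but not below, so overshooting to the left costs a large gradient.\<close>

lemma half_huber_deriv: "(half_huber has_real_derivative min 1 x) (at x)"
proof (cases x "1::real" rule: linorder_cases)
  case less
  have "((\<lambda>x. x\<^sup>2 / 2) has_real_derivative min 1 x) (at x)"
    using less by (auto intro!: derivative_eq_intros)
  then show ?thesis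
    by (rule has_field_derivative_transform_within_open[where S="{..<1}"])
      (use less in \<open>auto simp: half_huber_def\<close>)
next
  case greater
  have "((\<lambda>x. x - 1 / 2) has_real_derivative min 1 x) (at x)"
    using greater by (auto intro!: derivative_eq_intros)
  then show ?thesis
    by (rule has_field_derivative_transform_within_open[where S="{1<..}"])
      (use greater in \<open>auto simp: half_huber_def\<close>)
next
  case equal
  \<comment> \<open>At the junction both branches have one-sided slope \<open>1\<close>, and the
    one-sided limits combine.\<close>
  have "((\<lambda>x. x - 1 / 2) has_real_derivative 1) (at 1 within {1..})"
    "((\<lambda>x. x\<^sup>2 / 2) has_real_derivative 1) (at (1::real) within {..1})"
    by (auto intro!: derivative_eq_intros)
  then have "(half_huber has_real_derivative 1) (at 1 within {1..})"
    "(half_huber has_real_derivative 1) (at 1 within {..1})"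
    by (auto simp: half_huber_def power2_eq_square
        elim!: has_field_derivative_transform_within[where d=1])
  then have "(half_huber has_real_derivative 1) (at 1 within {1..} \<union> {..1})"
    by (simp add: has_field_derivative_iff Lim_within_Un)
  moreover have "{1..} \<union> {..1} = (UNIV :: real set)"
    by auto
  ultimately show ?thesis
    using equal by simp
qed

lemma half_huber_nonneg: "half_huber x \<ge> 0"
  by (simp add: half_huber_def)

section \<open>The objective as a member of the class in dimension one\<close>

definition scaled_huber :: "real \<Rightarrow> (nat \<Rightarrow> real) \<Rightarrow> real" where
  "scaled_huber L x = L * half_huber (x 0)"

text \<open>The constant \<open>1\<close> enumerates the standard basis of the reals, so the
  \<open>coords\<close> lemmas transfer facts about real functions to \<open>Rn 1\<close>.\<close>

abbreviation line_point :: "real \<Rightarrow> nat \<Rightarrow> real" where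
  "line_point \<equiv> coords (\<lambda>_. 1)"

lemma bij_line: "bij_betw (\<lambda>_. 1) {..<DIM(real)} (Basis :: real set)"
  by (auto simp: bij_betw_def inj_on_def)

lemma scaled_huber_line_point: "scaled_huber L (line_point x) = L * half_huber x"
  by (simp add: scaled_huber_def coords_def)

lemma line_point_in_Rn: "line_point x \<in> Rn 1"
  using coords_image[OF bij_line] by auto

lemma scaled_huber_gradient:
  "gradient 1 (scaled_huber L) (line_point x) = line_point (L * min 1 x)"
proof (rule gradient_eqI[OF _ line_point_in_Rn])
  have "((\<lambda>x. L * half_huber x) has_derivative (\<lambda>h. (L * min 1 x) \<bullet> h)) (at x)"
    using DERIV_cmult[OF half_huber_deriv, of L x] by (simp add: has_field_derivative_def)
  then show "has_gradient 1 (scaled_huber L) (line_point (L * min 1 x)) (line_point x)"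
    using has_gradient_coords[OF bij_line] by (simp add: scaled_huber_line_point)
qed

lemma smooth_convex_scaled_huber:
  assumes "L > 0"
  shows "smooth_convex 1 L (scaled_huber L)"
proof -
  have deriv: "((\<lambda>x. L * half_huber x) has_real_derivative L * min 1 x) (at x)" for x
    by (rule DERIV_cmult[OF half_huber_deriv])
  have "convex_on UNIV (\<lambda>x. L * half_huber x)"
    by (rule convex_on_realI[OF _ deriv]) (use assms in auto)
  moreover have "\<forall>x. L * half_huber 0 \<le> L * half_huber x"
    using assms half_huber_nonneg by (simp add: half_huber_def)
  then have "\<exists>z. \<forall>x. L * half_huber z \<le> L * half_huber x"
    by blast
  moreover have "\<exists>G. (\<forall>x. ((\<lambda>x. L * half_huber x) has_derivative (\<bullet>) (G x)) (at x)) \<and>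
      (\<forall>x y. norm (G x - G y) \<le> L * norm (x - y))"
  proof (intro exI[of _ "\<lambda>x. L * min 1 x"] conjI allI)
    show "((\<lambda>x. L * half_huber x) has_derivative ((\<bullet>) (L * min 1 x))) (at x)" for x
      using deriv by (simp add: has_field_derivative_def)
    fix x y :: real
    have "norm (L * min 1 x - L * min 1 y) = L * \<bar>min 1 x - min 1 y\<bar>"
      using assms by (simp add: abs_mult flip: right_diff_distrib)
    also have "\<dots> \<le> L * norm (x - y)"
      using assms by (intro mult_left_mono) auto
    finally show "norm (L * min 1 x - L * min 1 y) \<le> L * norm (x - y)" .
  qed
  ultimately show ?thesis
    using smooth_convex_coords[OF bij_line, of L "scaled_huber L"]
    unfolding Let_def scaled_huber_line_point DIM_real by blast
qed

lemma fstar_scaled_huber: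
  assumes "L > 0"
  shows "fstar 1 (scaled_huber L) = 0"
  unfolding fstar_def
proof (rule cInf_eq_minimum)
  have "0 = scaled_huber L (line_point 0)"
    by (simp add: scaled_huber_line_point half_huber_def)
  then show "0 \<in> scaled_huber L ` Rn 1"
    using line_point_in_Rn by blast
qed (use assms half_huber_nonneg in \<open>auto simp: scaled_huber_def\<close>)

section \<open>Lower bounds on the worst case\<close>

lemma worst_case_dim_huber:
  fixes \<beta> :: "nat \<Rightarrow> nat \<Rightarrow> real"
  defines "s \<equiv> \<lambda>k. \<Sum>i<k. \<beta> i k"
  assumes L: "L > 0" and x: "x \<ge> 1" and le: "\<And>k. k < N \<Longrightarrow> s k \<le> x - 1"
  shows "ereal ((min 1 (x - s N))\<^sup>2 / (x - 1 / 2)) \<le> worst_case_dim L \<beta> 1 N"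
proof -
  \<comment> \<open>An iterate depends only on gradients at earlier ones. Hence \<open>le\<close>
    can stop before \<open>N\<close>, and \<open>x - s N\<close> may lie on the quadratic
    part.\<close>
  have iter: "iterate L \<beta> 1 (scaled_huber L) (line_point x) k = line_point (x - s k)"
    if "k \<le> N" for k
    using that
  proof (induction k rule: less_induct)
    case (less k)
    have "gradient 1 (scaled_huber L) (iterate L \<beta> 1 (scaled_huber L) (line_point x) i) =
        line_point L" if "i < k" for i
      using less.IH[OF that] le[of i] that less.prems
      by (simp add: scaled_huber_gradient del: One_nat_def)
    then show ?case
      using L by (subst iterate.simps) (auto simp: coords_def s_def sum_divide_distrib simp flip: sum_distrib_right)
  qed
  have f: "scaled_huber L (line_point x) = L * (x - 1 / 2)"
    using x by (auto simp: scaled_huber_line_point half_huber_def)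
  have norm: "enorm 1 (line_point g) = \<bar>g\<bar>" for g
    using enorm_coords[OF bij_line, of g] by simp
  have mem: "(scaled_huber L, line_point x) \<in>
      {(f, x0). smooth_convex 1 L f \<and> x0 \<in> Rn 1 \<and> f x0 > fstar 1 f}"
    using L x smooth_convex_scaled_huber line_point_in_Rn
    by (auto simp: fstar_scaled_huber f simp del: One_nat_def)
  have "ereal ((enorm 1 (gradient 1 (scaled_huber L)
        (iterate L \<beta> 1 (scaled_huber L) (line_point x) N)))\<^sup>2 /
        (L * (scaled_huber L (line_point x) - fstar 1 (scaled_huber L))))
      \<le> worst_case_dim L \<beta> 1 N"
    unfolding worst_case_dim_def by (rule SUP_upper2[OF mem]) simp
  then show ?thesis
    using L by (simp add: iter scaled_huber_gradient fstar_scaled_huber f norm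
        power_mult_distrib power2_eq_square del: One_nat_def)
qed

section \<open>Incompatibility of the two growth conditions\<close>

text \<open>
  The square root is linearised at \<open>1\<close>, the value of its argument when \<open>m n = n / c\<close>. This keeps the
  critical value: the slope of the resulting comparison sequence,
  \<open>3 / (2 - c)\<close>, is below \<open>1 / c\<close> exactly when \<open>c < 1 / 2\<close>.
\<close>
lemma growth_contradiction:
  fixes m :: "nat \<Rightarrow> real"
  assumes c: "0 < c" "c < 1 / 2"
    and lower: "\<And>n. n \<ge> K \<Longrightarrow> real n / c \<le> m n"
    and step: "\<And>n. n \<ge> K \<Longrightarrow> m (Suc n) \<le> m n + 1 + sqrt (c * m n / real (Suc n))"
  shows False
proof -
  \<comment> \<open>\<open>A\<close> solves \<open>A = c * A / 2 + 3 / 2\<close>, the balance of the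
    linearised recursion for a linear sequence.\<close>
  define A where "A = 3 / (2 - c)"
  have "2 - c \<noteq> 0"
    using c by simp
  then have "A * (2 - c) = 3"
    using nonzero_eq_divide_eq A_def by blast
  then have A: "A - c * A / 2 = 3 / 2"
    by (simp add: algebra_simps)
  have A': "A > 0" "A < 1 / c"
    using c by (auto simp: A_def field_simps)
  define K' where "K' = Suc K"
  define B where "B = max 0 (m K')"
  \<comment> \<open>The term \<open>B * sqrt n\<close> absorbs the initial value: the homogeneous
    recursion grows only like n to the power \<open>c / 2\<close>, with
    \<open>c / 2 < 1 / 4\<close>.\<close>
  have upper: "m n \<le> A * n + B * sqrt n" if "n \<ge> K'" for n
    using that
  proof (induction n rule: dec_induct)
    case base
    have "B * 1 \<le> B * sqrt K'"
      by (intro mult_left_mono) (auto simp: B_def K'_def)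
    moreover have "m K' \<le> B" "0 \<le> A * K'"
      using A' by (auto simp: B_def)
    ultimately show ?case by linarith
  next
    case (step n)
    have n: "n \<ge> K" "n > 0" using step by (auto simp: K'_def)
    have m0: "0 \<le> m n"
      using lower[OF n(1)] c by (meson divide_nonneg_pos of_nat_0_le_iff order_trans)
    define t where "t = c * m n / real (Suc n)"
    have "t \<ge> 0" using m0 c by (simp add: t_def)
    then have "sqrt t \<le> (t + 1) / 2"
      using arith_geo_mean_sqrt[of t 1] by simp
    moreover have "m (Suc n) \<le> m n + 1 + sqrt t"
      using assms(4)[OF n(1)] by (simp add: t_def)
    ultimately have "m (Suc n) \<le> m n + t / 2 + 3 / 2"
      by argo
    also have "\<dots> = m n * (1 + c / (2 * Suc n)) + 3 / 2"
      by (simp add: t_def field_simps)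
    also have "\<dots> \<le> (A * n + B * sqrt n) * (1 + c / (2 * Suc n)) + 3 / 2"
      using step.IH c by (intro add_right_mono mult_right_mono) auto
    also have "\<dots> = A * n * (1 + c / (2 * Suc n)) + 3 / 2 + B * (sqrt n * (1 + c / (2 * Suc n)))"
      by (simp only: distrib_right mult.assoc add.assoc add.commute)
    also have "\<dots> \<le> A * Suc n + B * sqrt (Suc n)"
    proof (rule add_mono)
      have "c * A / 2 * (real n / Suc n) \<le> c * A / 2"
        using A' c by (intro mult_left_le) auto
      moreover have "A * n * (1 + c / (2 * Suc n)) = A * n + c * A / 2 * (real n / Suc n)"
        by (simp add: field_simps)
      moreover have "A * Suc n = A * n + A"
        by (simp add: algebra_simps)
      ultimately show "A * n * (1 + c / (2 * Suc n)) + 3 / 2 \<le> A * Suc n"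
        using A by argo
      have "sqrt n * (1 + c / (2 * Suc n)) \<le> sqrt (Suc n)"
      proof (rule real_le_rsqrt)
        define q where "q = 1 / real (Suc n)"
        have q: "0 < q" "q \<le> 1" "real n * q = 1 - q" "c / (2 * Suc n) = c / 2 * q"
          by (auto simp: q_def field_simps)
        have "c / 2 * q \<le> 1 / 4 * q" using q c by (intro mult_right_mono) auto
        then have "(1 + c / 2 * q)\<^sup>2 \<le> (1 + 1 / 4 * q)\<^sup>2"
          using c q by (intro power_mono) auto
        also have "\<dots> \<le> 1 + q"
        proof -
          have "(1 + 1 / 4 * q)\<^sup>2 = 1 + q / 2 + q * q / 16"
            by (simp add: power2_eq_square algebra_simps)
          moreover have "q * q \<le> q"
            using q by (simp add: mult_left_le)
          ultimately show ?thesis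
            using q by linarith
        qed
        finally have "real n * (1 + c / 2 * q)\<^sup>2 \<le> real n * (1 + q)"
          by (intro mult_left_mono) auto
        also have "\<dots> \<le> Suc n" using q by (simp add: algebra_simps)
        finally show "(sqrt n * (1 + c / (2 * Suc n)))\<^sup>2 \<le> Suc n"
          unfolding power_mult_distrib q(4) by simp
      qed
      then show "B * (sqrt n * (1 + c / (2 * Suc n))) \<le> B * sqrt (Suc n)"
        by (intro mult_left_mono) (auto simp: B_def)
    qed
    finally show ?case .
  qed
  define e where "e = 1 / c - A"
  have e: "e > 0" using A' by (simp add: e_def)
  obtain k :: nat where k: "B / e < k" using reals_Archimedean2 by blast
  \<comment> \<open>At index \<open>p\<^sup>2\<close> the square root is \<open>p\<close>, and the
    linear gap \<open>e * p\<^sup>2\<close> exceeds \<open>B * p\<close> once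
    \<open>p > B / e\<close>.\<close>
  define p where "p = k + K'"
  have p: "p > 0" "p \<ge> K'" "p \<ge> k" "p\<^sup>2 \<ge> p"
    by (auto simp: p_def K'_def power2_eq_square)
  then have "real (p\<^sup>2) / c \<le> A * real (p\<^sup>2) + B * sqrt (real (p\<^sup>2))"
    by (intro order_trans[OF lower upper]) (auto simp: K'_def)
  then have "e * p * p \<le> B * p"
    by (simp add: e_def power2_eq_square algebra_simps)
  then have "e * p \<le> B"
    using p(1) by (meson mult_right_le_imp_le of_nat_0_less_iff)
  moreover have "B < e * k" using k e by (simp add: field_simps)
  moreover have "e * k \<le> e * p" using e p by (intro mult_left_mono) auto
  ultimately show False by linarith
qed

section \<open>The limsup bounds\<close>

lemma limsup_worst_case_dim_1:
  assumes L: "L > 0"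
  shows "limsup (\<lambda>N. ereal (real N) * worst_case_dim L \<beta> 1 N) \<ge> ereal (1 / 2)"
proof (rule ccontr)
  assume "\<not> ?thesis"
  then obtain c' where c': "limsup (\<lambda>N. ereal (real N) * worst_case_dim L \<beta> 1 N) < ereal c'"
    "ereal c' < ereal (1 / 2)"
    using ereal_dense2[of _ "ereal (1 / 2)"] by (metis not_le)
  \<comment> \<open>\<open>c'\<close> may be nonpositive; the maximum makes \<open>c\<close>
    positive and keeps it below \<open>1 / 2\<close>.\<close>
  define c where "c = max c' (1 / 4)"
  have c: "0 < c" "c < 1 / 2" using c' by (auto simp: c_def)
  obtain K where K: "\<And>N. N \<ge> K \<Longrightarrow> ereal (real N) * worst_case_dim L \<beta> 1 N < ereal c'"
    using Limsup_lessD[OF c'(1)] unfolding eventually_sequentially by blast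
  define s where "s = (\<lambda>k. \<Sum>i<k. \<beta> i k)"
  define M where "M = (\<lambda>n. Max (s ` {..n}))"
  have M_ge: "s k \<le> M n" if "k \<le> n" for k n
    unfolding M_def by (rule Max_ge) (use that in auto)
  \<comment> \<open>\<open>s 0\<close> is an empty sum, so the start \<open>M n + 1\<close> used
    below is at least \<open>1\<close>.\<close>
  have M_nonneg: "M n \<ge> 0" for n
    using M_ge[of 0 n] by (simp add: s_def)
  have M_Suc: "M (Suc n) = max (s (Suc n)) (M n)" for n
    by (simp add: M_def atMost_Suc)
  have bound: "real N * (min 1 (x - s N))\<^sup>2 \<le> c * (x - 1 / 2)"
    if "N \<ge> K" "x \<ge> 1" "\<And>k. k < N \<Longrightarrow> s k \<le> x - 1" for N x
  proof -
    have "ereal (real N) * ereal ((min 1 (x - s N))\<^sup>2 / (x - 1 / 2))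
        \<le> ereal (real N) * worst_case_dim L \<beta> 1 N"
      using worst_case_dim_huber[OF L, of x N \<beta>] that by (intro ereal_mult_left_mono) (auto simp: s_def)
    also have "\<dots> < ereal c'" by (rule K[OF that(1)])
    finally have "real N * ((min 1 (x - s N))\<^sup>2 / (x - 1 / 2)) \<le> c"
      by (simp add: c_def)
    then show ?thesis using that(2) by (simp add: field_simps)
  qed
  show False
  proof (rule growth_contradiction[OF c, of K "\<lambda>n. M n + 1 / 2"])
    fix n assume n: "n \<ge> K"
    \<comment> \<open>\<open>M n + 1\<close> is the leftmost start that keeps all iterates up to
      \<open>n\<close> at \<open>1\<close> or beyond. Its optimality gap is
      \<open>L * (M n + 1 / 2)\<close>.\<close>
    have "real n * (min 1 (M n + 1 - s n))\<^sup>2 \<le> c * (M n + 1 - 1 / 2)"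
      using n M_nonneg M_ge by (intro bound) auto
    moreover have "min 1 (M n + 1 - s n) = 1" using M_ge[of n n] by simp
    ultimately show "real n / c \<le> M n + 1 / 2"
      using c by (simp add: field_simps)
    let ?r = "c * (M n + 1 / 2) / real (Suc n)"
    have r0: "?r \<ge> 0" using c M_nonneg[of n] by simp
    show "M (Suc n) + 1 / 2 \<le> M n + 1 / 2 + 1 + sqrt ?r"
    proof (cases "s (Suc n) \<le> M n")
      case True
      then show ?thesis using r0 by (simp add: M_Suc)
    next
      case False
      \<comment> \<open>From the same start, the next iterate falls below \<open>1\<close>, where
        the slope measures the overshoot.\<close>
      have "real (Suc n) * (min 1 (M n + 1 - s (Suc n)))\<^sup>2 \<le> c * (M n + 1 - 1 / 2)"
        using n M_nonneg M_ge by (intro bound) auto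
      moreover have "min 1 (M n + 1 - s (Suc n)) = M n + 1 - s (Suc n)" using False by simp
      ultimately have "(s (Suc n) - M n - 1)\<^sup>2 \<le> ?r"
        by (simp add: field_simps power2_eq_square)
      then have "s (Suc n) - M n - 1 \<le> sqrt ?r" by (rule real_le_rsqrt)
      then show ?thesis using False by (simp add: M_Suc)
    qed
  qed
qed

theorem theorem4:
  fixes L :: real and \<beta> :: "nat \<Rightarrow> nat \<Rightarrow> real"
  assumes "L > 0"
  shows "limsup (\<lambda>N. ereal (real N) * worst_case L \<beta> N) \<ge> ereal (1 / 2) \<and>
         limsup (\<lambda>N. ereal (real N) * worst_case_dim L \<beta> 1 N) \<ge> ereal (1 / 2)"
proof -
  have "worst_case_dim L \<beta> 1 N \<le> worst_case L \<beta> N" for N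
    unfolding worst_case_def by (rule SUP_upper) simp
  then have "limsup (\<lambda>N. ereal (real N) * worst_case_dim L \<beta> 1 N)
      \<le> limsup (\<lambda>N. ereal (real N) * worst_case L \<beta> N)"
    by (intro Limsup_mono always_eventually allI ereal_mult_left_mono) auto
  with limsup_worst_case_dim_1[OF assms, of \<beta>] show ?thesis
    using order_trans by blast
qed

end
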